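(* Let $\mathbb{C}$ be a regular unital category with binary coproducts, comonadic covers $(P,\delta,\varepsilon)$ and a natural imaginary splitting $t$. Suppose that the natural addition $(\mu^X\colon X\times X\dashrightarrow X)_{X\in\mathbb{C}}$ is associative. Then every intrinsic Schreier special object of $\mathbb{C}$ is a protomodular object.
   Context: Setting. A pointed finitely complete category is unital when for all objects $A,B$ the pair $\langle 1_A,0\rangle\colon A\to A\times B$, $\langle 0,1_B\rangle\colon B\to A\times B$ is jointly extremal-epimorphic. "Comonadic covers" means a comonad $(P,\delta,\varepsilon)$ on $\mathbb{C}$ such that every $\varepsilon_X\colon P(X)\to X$ is a regular epimorphism. A natural imaginary splitting is a natural transformation with components $t_{A,B}\colon P(A\times B)\to A+B$ such that $r_{A,B}t_{A,B}=\varepsilon_{A\times B}$, where $r_{A,B}\colon A+B\to A\times B$ is the canonical comparison morphism (with $\pi_A r_{A,B}=(1_A\;0)$ and $\pi_B r_{A,B}=(0\;1_B)$). Imaginary morphisms. An imaginary morphism $a\colon X\dashrightarrow Y$ is a morphism $a\colon P(X)\to Y$ in $\mathbb{C}$, i.e. a morphism of the Kleisli category of $P$; composition of $a\colon A\dashrightarrow B$ and $b\colon B\dashrightarrow C$ is $b\circ a=b\,P(a)\,\delta_A$. A real morphism $f\colon X\to Y$ of $\mathbb{C}$ is viewed as $\overline{f}=f\varepsilon_X\colon X\dashrightarrow Y$; for real $v$, $u$ one writes $v\circ a=va\;(=\overline{v}\circ a)$ and $a\circ u=aP(u)\;(=a\circ\overline{u})$. Finite products of $\mathbb{C}$ are also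 products for imaginary morphisms: $\langle a,b\rangle$ is the usual pairing in $\mathbb{C}$, and $a\times b=\langle a\circ\pi_1,b\circ\pi_2\rangle$. Imaginary addition: $\mu^X\colon X\times X\dashrightarrow X$ is $\mu^X=(1_X\;1_X)\,t_{X,X}\colon P(X\times X)\to X+X\to X$. The natural addition is associative when $\mu^X\circ(\mu^X\times\overline{1_X})=\mu^X\circ(\overline{1_X}\times\mu^X)$ as imaginary morphisms $X\times X\times X\dashrightarrow X$ for every object $X$. Intrinsic Schreier split epimorphism: a split epimorphism $f\colon X\to Y$ with chosen section $s$ and kernel $k\colon K\to X$ for which there is an imaginary morphism $q\colon X\dashrightarrow K$ with $\mu^X\circ\langle k\circ q,\overline{sf}\rangle=\overline{1_X}$ and $q\circ\mu^X\circ(k\times s)=\overline{\pi_K}$, where $\pi_K\colon K\times Y\to K$ is the projection. Intrinsic Schreier special object: an object $Y$ such that the split epimorphism $\pi_2\colon Y\times Y\to Y$ with section $\langle 1_Y,1_Y\rangle$ and kernel $\langle 1_Y,0\rangle$ is an intrinsic Schreier split epimorphism. Protomodular object: an object $Y$ such that every split epimorphism with chosen section $(f\colon X\to Y,\ s\colon Y\to X)$ over $Y$ is stably strong, meaning that for every morphism $g\colon Z\to Y$ the pullback of $(f,s)$ along $g$ is a split epimorphism whose kernel and section are jointly extremal-epimorphic. *)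

theory Defs
  imports Main
begin

section \<open>Categories\<close>

record ('o, 'm) category =
  Obj :: "'o set"
  Arr :: "'m set"
  Dom :: "'m \<Rightarrow> 'o"
  Cod :: "'m \<Rightarrow> 'o"
  Ident :: "'o \<Rightarrow> 'm"
  Comp :: "'m \<Rightarrow> 'm \<Rightarrow> 'm" (infixr "\<cdot>\<index>" 70)

definition hom :: "('o, 'm, 'x) category_scheme \<Rightarrow> 'o \<Rightarrow> 'o \<Rightarrow> 'm set" where
  "hom C A B = {f \<in> Arr C. Dom C f = A \<and> Cod C f = B}"

locale category =
  fixes C :: "('o, 'm, 'x) category_scheme" (structure)
  assumes Dom_Obj: "f \<in> Arr C \<Longrightarrow> Dom C f \<in> Obj C"
    and Cod_Obj: "f \<in> Arr C \<Longrightarrow> Cod C f \<in> Obj C"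
    and Ident_hom: "A \<in> Obj C \<Longrightarrow> Ident C A \<in> hom C A A"
    and Comp_hom: "f \<in> hom C A B \<Longrightarrow> g \<in> hom C B D \<Longrightarrow> g \<cdot> f \<in> hom C A D"
    and Comp_Ident: "f \<in> hom C A B \<Longrightarrow> f \<cdot> Ident C A = f"
    and Ident_Comp: "f \<in> hom C A B \<Longrightarrow> Ident C B \<cdot> f = f"
    and Comp_assoc:
      "f \<in> hom C A B \<Longrightarrow> g \<in> hom C B D \<Longrightarrow> h \<in> hom C D E \<Longrightarrow> (h \<cdot> g) \<cdot> f = h \<cdot> (g \<cdot> f)"

definition is_mono :: "('o, 'm, 'x) category_scheme \<Rightarrow> 'm \<Rightarrow> bool" where
  "is_mono C m \<longleftrightarrow> m \<in> Arr C \<and>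
     (\<forall>u \<in> Arr C. \<forall>v \<in> Arr C. Dom C u = Dom C v \<and> Cod C u = Dom C m \<and> Cod C v = Dom C m \<and>
        m \<cdot>\<^bsub>C\<^esub> u = m \<cdot>\<^bsub>C\<^esub> v \<longrightarrow> u = v)"

definition is_iso :: "('o, 'm, 'x) category_scheme \<Rightarrow> 'm \<Rightarrow> bool" where
  "is_iso C m \<longleftrightarrow> m \<in> Arr C \<and>
     (\<exists>n \<in> hom C (Cod C m) (Dom C m).
        n \<cdot>\<^bsub>C\<^esub> m = Ident C (Dom C m) \<and> m \<cdot>\<^bsub>C\<^esub> n = Ident C (Cod C m))"

definition is_coequalizer :: "('o, 'm, 'x) category_scheme \<Rightarrow> 'm \<Rightarrow> 'm \<Rightarrow> 'm \<Rightarrow> bool" where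
  "is_coequalizer C u v e \<longleftrightarrow>
     u \<in> Arr C \<and> v \<in> Arr C \<and> e \<in> Arr C \<and>
     Dom C u = Dom C v \<and> Cod C u = Dom C e \<and> Cod C v = Dom C e \<and>
     e \<cdot>\<^bsub>C\<^esub> u = e \<cdot>\<^bsub>C\<^esub> v \<and>
     (\<forall>h \<in> Arr C. Dom C h = Dom C e \<and> h \<cdot>\<^bsub>C\<^esub> u = h \<cdot>\<^bsub>C\<^esub> v \<longrightarrow>
        (\<exists>!w. w \<in> hom C (Cod C e) (Cod C h) \<and> w \<cdot>\<^bsub>C\<^esub> e = h))"

definition regular_epi :: "('o, 'm, 'x) category_scheme \<Rightarrow> 'm \<Rightarrow> bool" where
  "regular_epi C e \<longleftrightarrow> (\<exists>u v. is_coequalizer C u v e)"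

definition jointly_extremal_epi :: "('o, 'm, 'x) category_scheme \<Rightarrow> 'm \<Rightarrow> 'm \<Rightarrow> bool" where
  "jointly_extremal_epi C u v \<longleftrightarrow>
     u \<in> Arr C \<and> v \<in> Arr C \<and> Cod C u = Cod C v \<and>
     (\<forall>m u' v'. is_mono C m \<and> Cod C m = Cod C u \<and>
        u' \<in> hom C (Dom C u) (Dom C m) \<and> v' \<in> hom C (Dom C v) (Dom C m) \<and>
        m \<cdot>\<^bsub>C\<^esub> u' = u \<and> m \<cdot>\<^bsub>C\<^esub> v' = v \<longrightarrow> is_iso C m)"


section \<open>Finite limits, binary coproducts, zero object\<close>

definition is_terminal :: "('o, 'm, 'x) category_scheme \<Rightarrow> 'o \<Rightarrow> bool" where
  "is_terminal C Z \<longleftrightarrow> Z \<in> Obj C \<and> (\<forall>A \<in> Obj C. \<exists>!f. f \<in> hom C A Z)"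

definition is_initial :: "('o, 'm, 'x) category_scheme \<Rightarrow> 'o \<Rightarrow> bool" where
  "is_initial C Z \<longleftrightarrow> Z \<in> Obj C \<and> (\<forall>A \<in> Obj C. \<exists>!f. f \<in> hom C Z A)"

definition is_zero_object :: "('o, 'm, 'x) category_scheme \<Rightarrow> 'o \<Rightarrow> bool" where
  "is_zero_object C Z \<longleftrightarrow> is_initial C Z \<and> is_terminal C Z"

definition pointed :: "('o, 'm, 'x) category_scheme \<Rightarrow> bool" where
  "pointed C \<longleftrightarrow> (\<exists>Z. is_zero_object C Z)"

definition zero_arr :: "('o, 'm, 'x) category_scheme \<Rightarrow> 'o \<Rightarrow> 'o \<Rightarrow> 'm" where
  "zero_arr C A B =
     (THE f. \<exists>Z u v. is_zero_object C Z \<and> u \<in> hom C A Z \<and> v \<in> hom C Z B \<and> f = v \<cdot>\<^bsub>C\<^esub> u)"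

definition is_product ::
  "('o, 'm, 'x) category_scheme \<Rightarrow> 'o \<Rightarrow> 'o \<Rightarrow> 'o \<Rightarrow> 'm \<Rightarrow> 'm \<Rightarrow> bool" where
  "is_product C A B Q p q \<longleftrightarrow>
     p \<in> hom C Q A \<and> q \<in> hom C Q B \<and>
     (\<forall>X \<in> Obj C. \<forall>f \<in> hom C X A. \<forall>g \<in> hom C X B.
        \<exists>!h. h \<in> hom C X Q \<and> p \<cdot>\<^bsub>C\<^esub> h = f \<and> q \<cdot>\<^bsub>C\<^esub> h = g)"

definition is_coproduct ::
  "('o, 'm, 'x) category_scheme \<Rightarrow> 'o \<Rightarrow> 'o \<Rightarrow> 'o \<Rightarrow> 'm \<Rightarrow> 'm \<Rightarrow> bool" where
  "is_coproduct C A B S i j \<longleftrightarrow>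
     i \<in> hom C A S \<and> j \<in> hom C B S \<and>
     (\<forall>X \<in> Obj C. \<forall>f \<in> hom C A X. \<forall>g \<in> hom C B X.
        \<exists>!h. h \<in> hom C S X \<and> h \<cdot>\<^bsub>C\<^esub> i = f \<and> h \<cdot>\<^bsub>C\<^esub> j = g)"

definition is_equalizer :: "('o, 'm, 'x) category_scheme \<Rightarrow> 'm \<Rightarrow> 'm \<Rightarrow> 'm \<Rightarrow> bool" where
  "is_equalizer C f g e \<longleftrightarrow>
     f \<in> Arr C \<and> g \<in> Arr C \<and> e \<in> Arr C \<and>
     Cod C f = Cod C g \<and> Dom C f = Cod C e \<and> Dom C g = Cod C e \<and>
     f \<cdot>\<^bsub>C\<^esub> e = g \<cdot>\<^bsub>C\<^esub> e \<and>
     (\<forall>h \<in> Arr C. Cod C h = Cod C e \<and> f \<cdot>\<^bsub>C\<^esub> h = g \<cdot>\<^bsub>C\<^esub> h \<longrightarrow>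
        (\<exists>!w. w \<in> hom C (Dom C h) (Dom C e) \<and> e \<cdot>\<^bsub>C\<^esub> w = h))"

text \<open>\<open>is_pullback C p q f g\<close>: the square \<open>f \<cdot> p = g \<cdot> q\<close> is a pullback.\<close>

definition is_pullback :: "('o, 'm, 'x) category_scheme \<Rightarrow> 'm \<Rightarrow> 'm \<Rightarrow> 'm \<Rightarrow> 'm \<Rightarrow> bool" where
  "is_pullback C p q f g \<longleftrightarrow>
     p \<in> Arr C \<and> q \<in> Arr C \<and> f \<in> Arr C \<and> g \<in> Arr C \<and>
     Dom C p = Dom C q \<and> Cod C p = Dom C f \<and> Cod C q = Dom C g \<and> Cod C f = Cod C g \<and>
     f \<cdot>\<^bsub>C\<^esub> p = g \<cdot>\<^bsub>C\<^esub> q \<and>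
     (\<forall>X \<in> Obj C. \<forall>u \<in> hom C X (Dom C f). \<forall>v \<in> hom C X (Dom C g).
        f \<cdot>\<^bsub>C\<^esub> u = g \<cdot>\<^bsub>C\<^esub> v \<longrightarrow>
        (\<exists>!w. w \<in> hom C X (Dom C p) \<and> p \<cdot>\<^bsub>C\<^esub> w = u \<and> q \<cdot>\<^bsub>C\<^esub> w = v))"

definition is_kernel :: "('o, 'm, 'x) category_scheme \<Rightarrow> 'm \<Rightarrow> 'm \<Rightarrow> bool" where
  "is_kernel C k f \<longleftrightarrow> is_equalizer C f (zero_arr C (Dom C f) (Cod C f)) k"

definition finitely_complete :: "('o, 'm, 'x) category_scheme \<Rightarrow> bool" where
  "finitely_complete C \<longleftrightarrow>
     (\<exists>Z. is_terminal C Z) \<and>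
     (\<forall>A \<in> Obj C. \<forall>B \<in> Obj C. \<exists>Q p q. is_product C A B Q p q) \<and>
     (\<forall>f \<in> Arr C. \<forall>g \<in> Arr C. Dom C f = Dom C g \<and> Cod C f = Cod C g \<longrightarrow>
        (\<exists>e. is_equalizer C f g e))"

definition regular_category :: "('o, 'm, 'x) category_scheme \<Rightarrow> bool" where
  "regular_category C \<longleftrightarrow>
     category C \<and> finitely_complete C \<and>
     (\<forall>f u v. is_pullback C u v f f \<longrightarrow> (\<exists>e. is_coequalizer C u v e)) \<and>
     (\<forall>p q f g. is_pullback C p q f g \<and> regular_epi C f \<longrightarrow> regular_epi C q)"


section \<open>Chosen binary products and coproducts\<close>

text \<open>The functorial expressions \<open>A \<times> B\<close> and \<open>A + B\<close> presuppose a choice of products and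
  coproducts, which is carried as part of the structure.\<close>

record ('o, 'm) cartesian = "('o, 'm) category" +
  Prod :: "'o \<Rightarrow> 'o \<Rightarrow> 'o"
  Pr1 :: "'o \<Rightarrow> 'o \<Rightarrow> 'm"
  Pr2 :: "'o \<Rightarrow> 'o \<Rightarrow> 'm"

record ('o, 'm) bicartesian = "('o, 'm) cartesian" +
  Coprod :: "'o \<Rightarrow> 'o \<Rightarrow> 'o"
  In1 :: "'o \<Rightarrow> 'o \<Rightarrow> 'm"
  In2 :: "'o \<Rightarrow> 'o \<Rightarrow> 'm"

definition chosen_products :: "('o, 'm, 'x) cartesian_scheme \<Rightarrow> bool" where
  "chosen_products C \<longleftrightarrow>
     (\<forall>A \<in> Obj C. \<forall>B \<in> Obj C. is_product C A B (Prod C A B) (Pr1 C A B) (Pr2 C A B))"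

definition chosen_coproducts :: "('o, 'm, 'x) bicartesian_scheme \<Rightarrow> bool" where
  "chosen_coproducts C \<longleftrightarrow>
     (\<forall>A \<in> Obj C. \<forall>B \<in> Obj C. is_coproduct C A B (Coprod C A B) (In1 C A B) (In2 C A B))"

definition pair :: "('o, 'm, 'x) cartesian_scheme \<Rightarrow> 'm \<Rightarrow> 'm \<Rightarrow> 'm" where
  "pair C f g =
     (THE h. h \<in> hom C (Dom C f) (Prod C (Cod C f) (Cod C g)) \<and>
        Pr1 C (Cod C f) (Cod C g) \<cdot>\<^bsub>C\<^esub> h = f \<and> Pr2 C (Cod C f) (Cod C g) \<cdot>\<^bsub>C\<^esub> h = g)"

definition copair :: "('o, 'm, 'x) bicartesian_scheme \<Rightarrow> 'm \<Rightarrow> 'm \<Rightarrow> 'm" where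
  "copair C f g =
     (THE h. h \<in> hom C (Coprod C (Dom C f) (Dom C g)) (Cod C f) \<and>
        h \<cdot>\<^bsub>C\<^esub> In1 C (Dom C f) (Dom C g) = f \<and> h \<cdot>\<^bsub>C\<^esub> In2 C (Dom C f) (Dom C g) = g)"

definition prod_map :: "('o, 'm, 'x) cartesian_scheme \<Rightarrow> 'm \<Rightarrow> 'm \<Rightarrow> 'm" where
  "prod_map C f g =
     pair C (f \<cdot>\<^bsub>C\<^esub> Pr1 C (Dom C f) (Dom C g)) (g \<cdot>\<^bsub>C\<^esub> Pr2 C (Dom C f) (Dom C g))"

definition coprod_map :: "('o, 'm, 'x) bicartesian_scheme \<Rightarrow> 'm \<Rightarrow> 'm \<Rightarrow> 'm" where
  "coprod_map C f g =
     copair C (In1 C (Cod C f) (Cod C g) \<cdot>\<^bsub>C\<^esub> f) (In2 C (Cod C f) (Cod C g) \<cdot>\<^bsub>C\<^esub> g)"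

definition prod_assoc :: "('o, 'm, 'x) cartesian_scheme \<Rightarrow> 'o \<Rightarrow> 'o \<Rightarrow> 'o \<Rightarrow> 'm" where
  "prod_assoc C A B D =
     pair C (Pr1 C A B \<cdot>\<^bsub>C\<^esub> Pr1 C (Prod C A B) D)
       (pair C (Pr2 C A B \<cdot>\<^bsub>C\<^esub> Pr1 C (Prod C A B) D) (Pr2 C (Prod C A B) D))"

definition unital_category :: "('o, 'm, 'x) cartesian_scheme \<Rightarrow> bool" where
  "unital_category C \<longleftrightarrow>
     category C \<and> pointed C \<and> finitely_complete C \<and> chosen_products C \<and>
     (\<forall>A \<in> Obj C. \<forall>B \<in> Obj C.
        jointly_extremal_epi C (pair C (Ident C A) (zero_arr C A B))
          (pair C (zero_arr C B A) (Ident C B)))"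

definition coprod_to_prod :: "('o, 'm, 'x) bicartesian_scheme \<Rightarrow> 'o \<Rightarrow> 'o \<Rightarrow> 'm" where
  "coprod_to_prod C A B =
     pair C (copair C (Ident C A) (zero_arr C B A)) (copair C (zero_arr C A B) (Ident C B))"


section \<open>Comonadic covers and imaginary morphisms\<close>

record ('o, 'm) comonad_data =
  P_obj :: "'o \<Rightarrow> 'o"
  P_map :: "'m \<Rightarrow> 'm"
  comult :: "'o \<Rightarrow> 'm"
  counit :: "'o \<Rightarrow> 'm"

locale comonad = category C for C :: "('o, 'm, 'x) category_scheme" (structure) +
  fixes P :: "('o, 'm) comonad_data"
  assumes P_obj: "A \<in> Obj C \<Longrightarrow> P_obj P A \<in> Obj C"
    and P_hom: "f \<in> hom C A B \<Longrightarrow> P_map P f \<in> hom C (P_obj P A) (P_obj P B)"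
    and P_Ident: "A \<in> Obj C \<Longrightarrow> P_map P (Ident C A) = Ident C (P_obj P A)"
    and P_Comp:
      "f \<in> hom C A B \<Longrightarrow> g \<in> hom C B D \<Longrightarrow> P_map P (g \<cdot> f) = P_map P g \<cdot> P_map P f"
    and comult_hom: "A \<in> Obj C \<Longrightarrow> comult P A \<in> hom C (P_obj P A) (P_obj P (P_obj P A))"
    and counit_hom: "A \<in> Obj C \<Longrightarrow> counit P A \<in> hom C (P_obj P A) A"
    and comult_natural:
      "f \<in> hom C A B \<Longrightarrow> comult P B \<cdot> P_map P f = P_map P (P_map P f) \<cdot> comult P A"
    and counit_natural: "f \<in> hom C A B \<Longrightarrow> counit P B \<cdot> P_map P f = f \<cdot> counit P A"
    and counit_comult: "A \<in> Obj C \<Longrightarrow> counit P (P_obj P A) \<cdot> comult P A = Ident C (P_obj P A)"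
    and P_counit_comult: "A \<in> Obj C \<Longrightarrow> P_map P (counit P A) \<cdot> comult P A = Ident C (P_obj P A)"
    and comult_coassoc:
      "A \<in> Obj C \<Longrightarrow> comult P (P_obj P A) \<cdot> comult P A = P_map P (comult P A) \<cdot> comult P A"

definition comonadic_covers ::
  "('o, 'm, 'x) category_scheme \<Rightarrow> ('o, 'm) comonad_data \<Rightarrow> bool" where
  "comonadic_covers C P \<longleftrightarrow> comonad C P \<and> (\<forall>X \<in> Obj C. regular_epi C (counit P X))"

definition natural_imaginary_splitting ::
  "('o, 'm, 'x) bicartesian_scheme \<Rightarrow> ('o, 'm) comonad_data \<Rightarrow> ('o \<Rightarrow> 'o \<Rightarrow> 'm) \<Rightarrow> bool" where
  "natural_imaginary_splitting C P t \<longleftrightarrow>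
     (\<forall>A \<in> Obj C. \<forall>B \<in> Obj C.
        t A B \<in> hom C (P_obj P (Prod C A B)) (Coprod C A B) \<and>
        coprod_to_prod C A B \<cdot>\<^bsub>C\<^esub> t A B = counit P (Prod C A B)) \<and>
     (\<forall>f \<in> Arr C. \<forall>g \<in> Arr C.
        t (Cod C f) (Cod C g) \<cdot>\<^bsub>C\<^esub> P_map P (prod_map C f g) =
        coprod_map C f g \<cdot>\<^bsub>C\<^esub> t (Dom C f) (Dom C g))"

definition imag_hom ::
  "('o, 'm, 'x) category_scheme \<Rightarrow> ('o, 'm) comonad_data \<Rightarrow> 'o \<Rightarrow> 'o \<Rightarrow> 'm set" where
  "imag_hom C P X Y = hom C (P_obj P X) Y"

definition real_imag :: "('o, 'm, 'x) category_scheme \<Rightarrow> ('o, 'm) comonad_data \<Rightarrow> 'm \<Rightarrow> 'm" where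
  "real_imag C P f = f \<cdot>\<^bsub>C\<^esub> counit P (Dom C f)"

text \<open>An object \<open>A\<close> is not determined by \<open>P_obj P A\<close>, so the imaginary domain of an imaginary
  morphism has to be passed explicitly: \<open>imag_comp C P A b a\<close> is the composite of \<open>a\<close> from \<open>A\<close>
  to \<open>B\<close> followed by \<open>b\<close>, and \<open>imag_prod C P A B a b\<close> is the product of imaginary morphisms
  \<open>a\<close> out of \<open>A\<close> and \<open>b\<close> out of \<open>B\<close>. For real \<open>u\<close> and \<open>v\<close> the composites of \<open>u\<close> followed by
  \<open>a\<close>, and of \<open>a\<close> followed by \<open>v\<close>, are written out as \<open>a \<cdot> P_map P u\<close> and \<open>v \<cdot> a\<close>.\<close>

definition imag_comp ::
  "('o, 'm, 'x) category_scheme \<Rightarrow> ('o, 'm) comonad_data \<Rightarrow> 'o \<Rightarrow> 'm \<Rightarrow> 'm \<Rightarrow> 'm" where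
  "imag_comp C P A b a = b \<cdot>\<^bsub>C\<^esub> P_map P a \<cdot>\<^bsub>C\<^esub> comult P A"

definition imag_prod ::
  "('o, 'm, 'x) cartesian_scheme \<Rightarrow> ('o, 'm) comonad_data \<Rightarrow> 'o \<Rightarrow> 'o \<Rightarrow> 'm \<Rightarrow> 'm \<Rightarrow> 'm" where
  "imag_prod C P A B a b =
     pair C (a \<cdot>\<^bsub>C\<^esub> P_map P (Pr1 C A B)) (b \<cdot>\<^bsub>C\<^esub> P_map P (Pr2 C A B))"

definition imag_add :: "('o, 'm, 'x) bicartesian_scheme \<Rightarrow> ('o \<Rightarrow> 'o \<Rightarrow> 'm) \<Rightarrow> 'o \<Rightarrow> 'm" where
  "imag_add C t X = copair C (Ident C X) (Ident C X) \<cdot>\<^bsub>C\<^esub> t X X"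

text \<open>The two sides have imaginary domains \<open>(X \<times> X) \<times> X\<close> and \<open>X \<times> (X \<times> X)\<close>, both written
  \<open>X \<times> X \<times> X\<close> informally; they are compared along the canonical (real) isomorphism.\<close>

definition associative_addition ::
  "('o, 'm, 'x) bicartesian_scheme \<Rightarrow> ('o, 'm) comonad_data \<Rightarrow> ('o \<Rightarrow> 'o \<Rightarrow> 'm) \<Rightarrow> bool" where
  "associative_addition C P t \<longleftrightarrow>
     (\<forall>X \<in> Obj C.
        imag_comp C P (Prod C (Prod C X X) X) (imag_add C t X)
          (imag_prod C P (Prod C X X) X (imag_add C t X) (real_imag C P (Ident C X))) =
        imag_comp C P (Prod C X (Prod C X X)) (imag_add C t X)
          (imag_prod C P X (Prod C X X) (real_imag C P (Ident C X)) (imag_add C t X))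
          \<cdot>\<^bsub>C\<^esub> P_map P (prod_assoc C X X X))"


section \<open>Split epimorphisms and special objects\<close>

definition split_epi :: "('o, 'm, 'x) category_scheme \<Rightarrow> 'm \<Rightarrow> 'm \<Rightarrow> bool" where
  "split_epi C f s \<longleftrightarrow>
     f \<in> Arr C \<and> s \<in> hom C (Cod C f) (Dom C f) \<and> f \<cdot>\<^bsub>C\<^esub> s = Ident C (Cod C f)"

definition intrinsic_Schreier_split_epi ::
  "('o, 'm, 'x) bicartesian_scheme \<Rightarrow> ('o, 'm) comonad_data \<Rightarrow> ('o \<Rightarrow> 'o \<Rightarrow> 'm)
    \<Rightarrow> 'm \<Rightarrow> 'm \<Rightarrow> 'm \<Rightarrow> bool" where
  "intrinsic_Schreier_split_epi C P t f s k \<longleftrightarrow>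
     split_epi C f s \<and> is_kernel C k f \<and>
     (let X = Dom C f; Y = Cod C f; K = Dom C k in
       \<exists>q \<in> imag_hom C P X K.
         imag_comp C P X (imag_add C t X) (pair C (k \<cdot>\<^bsub>C\<^esub> q) (real_imag C P (s \<cdot>\<^bsub>C\<^esub> f)))
           = real_imag C P (Ident C X) \<and>
         imag_comp C P (Prod C K Y) q (imag_add C t X \<cdot>\<^bsub>C\<^esub> P_map P (prod_map C k s))
           = real_imag C P (Pr1 C K Y))"

definition intrinsic_Schreier_special ::
  "('o, 'm, 'x) bicartesian_scheme \<Rightarrow> ('o, 'm) comonad_data \<Rightarrow> ('o \<Rightarrow> 'o \<Rightarrow> 'm)
    \<Rightarrow> 'o \<Rightarrow> bool" where
  "intrinsic_Schreier_special C P t Y \<longleftrightarrow>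
     Y \<in> Obj C \<and>
     intrinsic_Schreier_split_epi C P t (Pr2 C Y Y)
       (pair C (Ident C Y) (Ident C Y)) (pair C (Ident C Y) (zero_arr C Y Y))"

definition strong_split_epi :: "('o, 'm, 'x) category_scheme \<Rightarrow> 'm \<Rightarrow> 'm \<Rightarrow> bool" where
  "strong_split_epi C f s \<longleftrightarrow>
     split_epi C f s \<and> (\<forall>k. is_kernel C k f \<longrightarrow> jointly_extremal_epi C k s)"

text \<open>The pullback of \<open>(f, s)\<close> along \<open>g\<close> is \<open>(f', s')\<close>, where \<open>s'\<close> is the morphism into the
  pullback induced by \<open>s \<cdot> g\<close> and the identity.\<close>

definition stably_strong :: "('o, 'm, 'x) category_scheme \<Rightarrow> 'm \<Rightarrow> 'm \<Rightarrow> bool" where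
  "stably_strong C f s \<longleftrightarrow>
     split_epi C f s \<and>
     (\<forall>g \<in> Arr C. \<forall>g' f' s'.
        is_pullback C g' f' f g \<and> s' \<in> hom C (Dom C g) (Dom C f') \<and>
        g' \<cdot>\<^bsub>C\<^esub> s' = s \<cdot>\<^bsub>C\<^esub> g \<and> f' \<cdot>\<^bsub>C\<^esub> s' = Ident C (Dom C g) \<longrightarrow>
        strong_split_epi C f' s')"

definition protomodular_object :: "('o, 'm, 'x) category_scheme \<Rightarrow> 'o \<Rightarrow> bool" where
  "protomodular_object C Y \<longleftrightarrow>
     Y \<in> Obj C \<and> (\<forall>f s. split_epi C f s \<and> Cod C f = Y \<longrightarrow> stably_strong C f s)"

end

theory Submission imports Defs begin

text \<open>
  An imaginary morphism from \<open>T\<close> to \<open>X\<close>, that is an arrow from \<open>P T\<close> to \<open>X\<close>, is treated as an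
  element of \<open>X\<close> at stage \<open>T\<close>. Composing a pair of elements with the imaginary addition defines
  \<open>x + y\<close>. Naturality of the splitting makes real arrows additive (\<open>real_imag_sum\<close>) and makes
  \<open>0\<close> a two-sided unit (\<open>imag_sum_zero\<close>), and the associativity hypothesis makes the addition of
  elements associative (\<open>imag_sum_assoc\<close>). So the elements of \<open>X\<close> at each stage form a monoid.

  For an intrinsic Schreier special \<open>Y\<close>, the imaginary morphism from \<open>Y \<times> Y\<close>
  to \<open>Y\<close> that witnesses this is a subtraction satisfying \<open>(x - y) + y = x\<close> and \<open>(x + y) - y = x\<close>
  (\<open>special_object_subtraction\<close>). A monoid with such a subtraction is a group, so each element of
  \<open>Y\<close> has a two-sided negative (\<open>special_object_negation\<close>).

  Given a split epimorphism \<open>(f, s)\<close> over \<open>Y\<close> and its pullback \<open>W\<close> along \<open>g\<close>, negation in \<open>Y\<close>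
  suffices to write every element \<open>(x, z)\<close> of \<open>W\<close> as a sum of an element of the kernel and an
  element of the image of the section:
  \<open>(x, z) = (x + s (- f x), 0) + (s (g z), z)\<close>. For the generic element this writes the counit of
  \<open>W\<close> as such a sum. Hence the counit factors through any subobject of \<open>W\<close> that contains the
  kernel and the section; being a regular epimorphism, it forces that subobject to be all of \<open>W\<close>.
\<close>

section \<open>Arrows, pairings and zero arrows\<close>

lemma hom_iff: "f \<in> hom C A B \<longleftrightarrow> f \<in> Arr C \<and> Dom C f = A \<and> Cod C f = B"
  by (simp add: hom_def)

context category
begin

lemma arr_comp [simp]:
  assumes "f \<in> Arr C" "g \<in> Arr C" "Cod C f = Dom C g"
  shows "g \<cdot> f \<in> Arr C" "Dom C (g \<cdot> f) = Dom C f" "Cod C (g \<cdot> f) = Cod C g"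
  using Comp_hom[of f "Dom C f" "Cod C f" g "Cod C g"] assms by (auto simp: hom_iff)

lemma arr_ident [simp]:
  assumes "A \<in> Obj C"
  shows "Ident C A \<in> Arr C" "Dom C (Ident C A) = A" "Cod C (Ident C A) = A"
  using Ident_hom[OF assms] by (auto simp: hom_iff)

lemma comp_ident [simp]: "f \<in> Arr C \<Longrightarrow> Dom C f = A \<Longrightarrow> f \<cdot> Ident C A = f"
  using Comp_Ident[of f A "Cod C f"] by (simp add: hom_iff)

lemma ident_comp [simp]: "f \<in> Arr C \<Longrightarrow> Cod C f = B \<Longrightarrow> Ident C B \<cdot> f = f"
  using Ident_Comp[of f "Dom C f" B] by (simp add: hom_iff)

lemma comp_assoc:
  assumes "f \<in> Arr C" "g \<in> Arr C" "h \<in> Arr C" "Cod C f = Dom C g" "Cod C g = Dom C h"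
  shows "(h \<cdot> g) \<cdot> f = h \<cdot> (g \<cdot> f)"
  using Comp_assoc[of f "Dom C f" "Cod C f" g "Cod C g" h "Cod C h"] assms
  by (auto simp: hom_iff)

lemma comp_reassoc:
  assumes "g \<cdot> f = k" "f \<in> Arr C" "g \<in> Arr C" "e \<in> Arr C" "Cod C f = Dom C g" "Cod C e = Dom C f"
  shows "g \<cdot> (f \<cdot> e) = k \<cdot> e"
  using assms comp_assoc[of e f g] by simp

lemma mono_cancel:
  assumes "is_mono C m" "m \<cdot> u = m \<cdot> v"
    and "u \<in> hom C A (Dom C m)" "v \<in> hom C A (Dom C m)"
  shows "u = v"
  using assms unfolding is_mono_def hom_iff by metis

lemma regular_epi_through_mono:
  assumes "regular_epi C e" "is_mono C m" "h \<in> hom C (Dom C e) (Dom C m)" "m \<cdot> h = e"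
  shows "is_iso C m"
proof -
  obtain u v where uv: "is_coequalizer C u v e" using assms(1) by (auto simp: regular_epi_def)
  have m: "m \<in> Arr C" using assms(2) by (simp add: is_mono_def)
  have a [simp]: "u \<in> Arr C" "v \<in> Arr C" "e \<in> Arr C" "Dom C v = Dom C u" "Cod C u = Dom C e"
    "Cod C v = Dom C e" and eq: "e \<cdot> u = e \<cdot> v"
    using uv by (simp_all add: is_coequalizer_def)
  have h [simp]: "h \<in> Arr C" "Dom C h = Dom C e" "Cod C h = Dom C m"
    using assms(3) by (auto simp: hom_iff)
  have cod: "Cod C e = Cod C m" using assms(4) m arr_comp(3)[of h m] by simp
  have up: "\<And>k. k \<in> Arr C \<Longrightarrow> Dom C k = Dom C e \<Longrightarrow> k \<cdot> u = k \<cdot> v \<Longrightarrow>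
      (\<exists>!w. w \<in> hom C (Cod C e) (Cod C k) \<and> w \<cdot> e = k)"
    using uv by (simp add: is_coequalizer_def)
  have "m \<cdot> (h \<cdot> u) = m \<cdot> (h \<cdot> v)"
    using eq assms(4) m by (simp flip: comp_assoc)
  then have "h \<cdot> u = h \<cdot> v"
    by (rule mono_cancel[OF assms(2), where A = "Dom C u"]) (simp_all add: hom_iff)
  then obtain w where w: "w \<in> hom C (Cod C e) (Dom C m)" "w \<cdot> e = h"
    using up[OF h(1,2)] h(3) by auto
  then have w' [simp]: "w \<in> Arr C" "Dom C w = Cod C e" "Cod C w = Dom C m" by (auto simp: hom_iff)
  have "(m \<cdot> w) \<cdot> e = e" using w(2) assms(4) m by (simp add: comp_assoc)
  moreover have "Ident C (Cod C e) \<cdot> e = e" by simp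
  moreover have "m \<cdot> w \<in> hom C (Cod C e) (Cod C e)" "Ident C (Cod C e) \<in> hom C (Cod C e) (Cod C e)"
    using m cod Cod_Obj[OF a(3)] by (simp_all add: hom_iff)
  ultimately have mw: "m \<cdot> w = Ident C (Cod C e)"
    using up[OF a(3) refl eq] by blast
  \<comment> \<open>\<open>m\<close> is now a split epimorphism; being monic, it is inverse to its section \<open>w\<close>.\<close>
  have "m \<cdot> (w \<cdot> m) = m \<cdot> Ident C (Dom C m)"
    using mw m cod by (simp add: Dom_Obj flip: comp_assoc)
  then have "w \<cdot> m = Ident C (Dom C m)"
    by (rule mono_cancel[OF assms(2), where A = "Dom C m"]) (simp_all add: hom_iff m cod Dom_Obj)
  then show ?thesis using mw m cod w(1) by (auto simp: is_iso_def)
qed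

lemma pullback_arr:
  assumes "is_pullback C p q f g"
  shows "p \<in> Arr C" "q \<in> Arr C" "f \<in> Arr C" "g \<in> Arr C" "Dom C p = Dom C q"
    "Cod C p = Dom C f" "Cod C q = Dom C g" "Cod C f = Cod C g" "f \<cdot> p = g \<cdot> q"
  using assms by (simp_all add: is_pullback_def)

lemma pullback_lift:
  assumes "is_pullback C p q f g" "X \<in> Obj C" "u \<in> hom C X (Dom C f)" "v \<in> hom C X (Dom C g)"
    and "f \<cdot> u = g \<cdot> v"
  obtains w where "w \<in> hom C X (Dom C q)" "p \<cdot> w = u" "q \<cdot> w = v"
proof -
  have "\<exists>!w. w \<in> hom C X (Dom C p) \<and> p \<cdot> w = u \<and> q \<cdot> w = v"
    using assms unfolding is_pullback_def by blast
  with that pullback_arr(5)[OF assms(1)] show thesis by metis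
qed

lemma pullback_arr_eqI:
  assumes pb: "is_pullback C p q f g"
    and w: "w \<in> hom C X (Dom C q)" and w': "w' \<in> hom C X (Dom C q)"
    and eq: "p \<cdot> w = p \<cdot> w'" "q \<cdot> w = q \<cdot> w'"
  shows "w = w'"
proof -
  note pb_arr = pullback_arr[OF pb]
  have "X \<in> Obj C" using w Dom_Obj by (auto simp: hom_iff)
  moreover have "p \<cdot> w' \<in> hom C X (Dom C f)" "q \<cdot> w' \<in> hom C X (Dom C g)"
    using w' pb_arr by (auto simp: hom_iff)
  moreover have "f \<cdot> p \<cdot> w' = g \<cdot> q \<cdot> w'"
    using w' pb_arr by (simp add: hom_iff flip: comp_assoc)
  ultimately have "\<exists>!h. h \<in> hom C X (Dom C p) \<and> p \<cdot> h = p \<cdot> w' \<and> q \<cdot> h = q \<cdot> w'"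
    using pb unfolding is_pullback_def by blast
  with w w' eq pb_arr(5) show ?thesis by metis
qed

lemma kernel_arr:
  assumes "is_kernel C k f"
  shows "k \<in> Arr C" "Cod C k = Dom C f"
  using assms by (simp_all add: is_kernel_def is_equalizer_def)

lemma kernel_lift:
  assumes "is_kernel C k f" "u \<in> Arr C" "Cod C u = Dom C f"
    and "f \<cdot> u = zero_arr C (Dom C f) (Cod C f) \<cdot> u"
  obtains w where "w \<in> hom C (Dom C u) (Dom C k)" "k \<cdot> w = u"
proof -
  have "\<exists>!w. w \<in> hom C (Dom C u) (Dom C k) \<and> k \<cdot> w = u"
    using assms by (simp add: is_kernel_def is_equalizer_def)
  with that show thesis by blast
qed

text \<open>Zero arrows are defined through an arbitrary zero object, so it has to be checked that the
  choice does not matter: any two are connected by an arrow, and the triangles on either side of it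
  commute by terminality and initiality.\<close>

lemma zero_object_factor_unique:
  assumes "is_zero_object C Z" "u \<in> hom C A Z" "v \<in> hom C Z B"
    and "is_zero_object C Z'" "u' \<in> hom C A Z'" "v' \<in> hom C Z' B"
  shows "v \<cdot> u = v' \<cdot> u'"
proof -
  have o: "Z \<in> Obj C" "Z' \<in> Obj C" "A \<in> Obj C" "B \<in> Obj C"
    using assms Dom_Obj Cod_Obj unfolding is_zero_object_def is_initial_def hom_iff by auto
  obtain i where i: "i \<in> hom C Z Z'"
    using assms(1) o unfolding is_zero_object_def is_initial_def by blast
  have "i \<cdot> u = u'"
    using assms(4,5) Comp_hom[OF assms(2) i] o
    unfolding is_zero_object_def is_terminal_def by blast
  moreover have "v' \<cdot> i = v"
    using assms(1,3) Comp_hom[OF i assms(6)] o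
    unfolding is_zero_object_def is_initial_def by blast
  ultimately show ?thesis using Comp_assoc[OF assms(2) i assms(6)] by simp
qed

lemma zero_arr_eq:
  assumes "is_zero_object C Z" "u \<in> hom C A Z" "v \<in> hom C Z B"
  shows "zero_arr C A B = v \<cdot> u"
  unfolding zero_arr_def
proof (rule the_equality)
  show "\<exists>Z u' v'. is_zero_object C Z \<and> u' \<in> hom C A Z \<and> v' \<in> hom C Z B \<and> v \<cdot> u = v' \<cdot> u'"
    using assms by blast
qed (use zero_object_factor_unique[OF _ _ _ assms] in blast)

lemma zero_arr_factors:
  assumes "pointed C" "A \<in> Obj C" "B \<in> Obj C"
  obtains Z u v where "is_zero_object C Z" "u \<in> hom C A Z" "v \<in> hom C Z B" "zero_arr C A B = v \<cdot> u"
proof -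
  obtain Z where Z: "is_zero_object C Z" using assms(1) by (auto simp: pointed_def)
  obtain u v where "u \<in> hom C A Z" "v \<in> hom C Z B"
    using Z assms(2,3) unfolding is_zero_object_def is_initial_def is_terminal_def by blast
  with Z zero_arr_eq[OF Z] that show thesis by blast
qed

lemma arr_zero:
  assumes "pointed C" "A \<in> Obj C" "B \<in> Obj C"
  shows "zero_arr C A B \<in> Arr C" "Dom C (zero_arr C A B) = A" "Cod C (zero_arr C A B) = B"
  using zero_arr_factors[OF assms] by (metis Comp_hom hom_iff)+

lemma comp_zero:
  assumes "pointed C" "A \<in> Obj C" "B \<in> Obj C" "f \<in> Arr C" "Dom C f = B"
  shows "f \<cdot> zero_arr C A B = zero_arr C A (Cod C f)"
proof -
  obtain Z u v where Z: "is_zero_object C Z" "u \<in> hom C A Z" "v \<in> hom C Z B"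
    "zero_arr C A B = v \<cdot> u" using zero_arr_factors[OF assms(1-3)] .
  have f: "f \<in> hom C B (Cod C f)" using assms by (simp add: hom_iff)
  show ?thesis
    using zero_arr_eq[OF Z(1,2) Comp_hom[OF Z(3) f]] Comp_assoc[OF Z(2,3) f] Z(4) by simp
qed

lemma zero_comp:
  assumes "pointed C" "A \<in> Obj C" "B \<in> Obj C" "f \<in> Arr C" "Cod C f = A"
  shows "zero_arr C A B \<cdot> f = zero_arr C (Dom C f) B"
proof -
  obtain Z u v where Z: "is_zero_object C Z" "u \<in> hom C A Z" "v \<in> hom C Z B"
    "zero_arr C A B = v \<cdot> u" using zero_arr_factors[OF assms(1-3)] .
  have f: "f \<in> hom C (Dom C f) A" using assms by (simp add: hom_iff)
  show ?thesis
    using zero_arr_eq[OF Z(1) Comp_hom[OF f Z(2)] Z(3)] Comp_assoc[OF f Z(2,3)] Z(4) by simp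
qed

end

locale cartesian_category = category C for C :: "('o, 'm, 'x) cartesian_scheme" (structure) +
  assumes products: "chosen_products C"
begin

lemma product:
  assumes "A \<in> Obj C" "B \<in> Obj C"
  shows "is_product C A B (Prod C A B) (Pr1 C A B) (Pr2 C A B)"
  using products assms by (simp add: chosen_products_def)

lemma arr_proj [simp]:
  assumes "A \<in> Obj C" "B \<in> Obj C"
  shows "Pr1 C A B \<in> Arr C" "Dom C (Pr1 C A B) = Prod C A B" "Cod C (Pr1 C A B) = A"
    "Pr2 C A B \<in> Arr C" "Dom C (Pr2 C A B) = Prod C A B" "Cod C (Pr2 C A B) = B"
  using product[OF assms] by (auto simp: is_product_def hom_iff)

lemma obj_prod [simp]: "A \<in> Obj C \<Longrightarrow> B \<in> Obj C \<Longrightarrow> Prod C A B \<in> Obj C"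
  using arr_proj[of A B] Dom_Obj by metis

lemma prod_arr_eqI:
  assumes "A \<in> Obj C" "B \<in> Obj C" "h \<in> hom C X (Prod C A B)" "k \<in> hom C X (Prod C A B)"
    and "Pr1 C A B \<cdot> h = Pr1 C A B \<cdot> k" "Pr2 C A B \<cdot> h = Pr2 C A B \<cdot> k"
  shows "h = k"
proof -
  have "X \<in> Obj C" "Pr1 C A B \<cdot> k \<in> hom C X A" "Pr2 C A B \<cdot> k \<in> hom C X B"
    using assms Dom_Obj by (auto simp: hom_iff)
  then show ?thesis
    using product[OF assms(1,2)] assms(3-6) unfolding is_product_def by metis
qed

lemma pair_spec:
  assumes "f \<in> Arr C" "g \<in> Arr C" "Dom C f = Dom C g"
  shows "pair C f g \<in> hom C (Dom C f) (Prod C (Cod C f) (Cod C g)) \<and>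
    Pr1 C (Cod C f) (Cod C g) \<cdot> pair C f g = f \<and> Pr2 C (Cod C f) (Cod C g) \<cdot> pair C f g = g"
  unfolding pair_def
proof (rule theI')
  have "Dom C f \<in> Obj C" "f \<in> hom C (Dom C f) (Cod C f)" "g \<in> hom C (Dom C f) (Cod C g)"
    using assms Dom_Obj by (auto simp: hom_iff)
  then show "\<exists>!h. h \<in> hom C (Dom C f) (Prod C (Cod C f) (Cod C g)) \<and>
     Pr1 C (Cod C f) (Cod C g) \<cdot> h = f \<and> Pr2 C (Cod C f) (Cod C g) \<cdot> h = g"
    using product[OF Cod_Obj Cod_Obj, of f g] assms unfolding is_product_def by blast
qed

lemma arr_pair [simp]:
  assumes "f \<in> Arr C" "g \<in> Arr C" "Dom C f = Dom C g"
  shows "pair C f g \<in> Arr C" "Dom C (pair C f g) = Dom C g"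
    "Cod C (pair C f g) = Prod C (Cod C f) (Cod C g)"
  using pair_spec[OF assms] assms(3) by (auto simp: hom_iff)

lemma proj_pair [simp]:
  assumes "f \<in> Arr C" "g \<in> Arr C" "Dom C f = Dom C g" "Cod C f = A" "Cod C g = B"
  shows "Pr1 C A B \<cdot> pair C f g = f" "Pr2 C A B \<cdot> pair C f g = g"
  using pair_spec[OF assms(1-3)] assms(4,5) by auto

lemma proj_pair_comp [simp]:
  assumes "f \<in> Arr C" "g \<in> Arr C" "Dom C f = Dom C g" "Cod C f = A" "Cod C g = B"
    and "h \<in> Arr C" "Cod C h = Dom C g"
  shows "Pr1 C A B \<cdot> (pair C f g \<cdot> h) = f \<cdot> h" "Pr2 C A B \<cdot> (pair C f g \<cdot> h) = g \<cdot> h"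
  using assms Cod_Obj by (auto simp flip: comp_assoc)

lemma pair_comp:
  assumes "f \<in> Arr C" "g \<in> Arr C" "h \<in> Arr C" "Dom C f = Cod C h" "Dom C g = Cod C h"
  shows "pair C f g \<cdot> h = pair C (f \<cdot> h) (g \<cdot> h)"
  by (rule prod_arr_eqI[of "Cod C f" "Cod C g" _ "Dom C h"])
    (use assms Cod_Obj in \<open>auto simp: hom_iff\<close>)

lemma arr_prod_map [simp]:
  assumes "f \<in> Arr C" "g \<in> Arr C"
  shows "prod_map C f g \<in> Arr C" "Dom C (prod_map C f g) = Prod C (Dom C f) (Dom C g)"
    "Cod C (prod_map C f g) = Prod C (Cod C f) (Cod C g)"
  using assms Dom_Obj by (auto simp: prod_map_def)

lemma prod_map_pair:
  assumes "f \<in> Arr C" "g \<in> Arr C" "u \<in> Arr C" "v \<in> Arr C" "Dom C u = Dom C v"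
    "Cod C u = Dom C f" "Cod C v = Dom C g"
  shows "prod_map C f g \<cdot> pair C u v = pair C (f \<cdot> u) (g \<cdot> v)"
  using assms Dom_Obj by (simp add: prod_map_def pair_comp comp_assoc)

end

section \<open>Imaginary morphisms\<close>

context comonad
begin

lemma arr_P [simp]:
  assumes "f \<in> Arr C"
  shows "P_map P f \<in> Arr C" "Dom C (P_map P f) = P_obj P (Dom C f)"
    "Cod C (P_map P f) = P_obj P (Cod C f)"
  using P_hom[of f "Dom C f" "Cod C f"] assms by (auto simp: hom_iff)

lemma arr_counit [simp]:
  assumes "A \<in> Obj C"
  shows "counit P A \<in> Arr C" "Dom C (counit P A) = P_obj P A" "Cod C (counit P A) = A"
  using counit_hom[OF assms] by (auto simp: hom_iff)

lemma arr_comult [simp]: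
  assumes "A \<in> Obj C"
  shows "comult P A \<in> Arr C" "Dom C (comult P A) = P_obj P A"
    "Cod C (comult P A) = P_obj P (P_obj P A)"
  using comult_hom[OF assms] by (auto simp: hom_iff)

lemma P_comp:
  assumes "f \<in> Arr C" "g \<in> Arr C" "Cod C f = Dom C g"
  shows "P_map P (g \<cdot> f) = P_map P g \<cdot> P_map P f"
  using P_Comp[of f "Dom C f" "Cod C f" g "Cod C g"] assms by (simp add: hom_iff)

lemma arr_imag_comp [simp]:
  assumes "T \<in> Obj C" "a \<in> Arr C" "Dom C a = P_obj P T" "b \<in> Arr C" "Dom C b = P_obj P (Cod C a)"
  shows "imag_comp C P T b a \<in> Arr C" "Dom C (imag_comp C P T b a) = P_obj P T"
    "Cod C (imag_comp C P T b a) = Cod C b"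
  using assms by (auto simp: imag_comp_def)

text \<open>Associativity of the Kleisli category of the comonad: naturality moves \<open>a\<close> past the
  comultiplication, and the two iterated comultiplications agree by coassociativity.\<close>

lemma imag_comp_assoc:
  assumes "T \<in> Obj C" "a \<in> hom C (P_obj P T) A" "b \<in> hom C (P_obj P A) B" "c \<in> hom C (P_obj P B) D"
  shows "imag_comp C P T (imag_comp C P A c b) a = imag_comp C P T c (imag_comp C P T b a)"
proof -
  have h [simp]: "a \<in> Arr C" "Dom C a = P_obj P T" "Cod C a = A" "b \<in> Arr C" "Dom C b = P_obj P A"
    "Cod C b = B" "c \<in> Arr C" "Dom C c = P_obj P B" "Cod C c = D" "T \<in> Obj C"
    using assms by (auto simp: hom_iff)
  have [simp]: "A \<in> Obj C" using Cod_Obj[of a] by simp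
  have nat: "comult P A \<cdot> P_map P a = P_map P (P_map P a) \<cdot> comult P (P_obj P T)"
    using comult_natural[OF assms(2)] by simp
  have "imag_comp C P T (imag_comp C P A c b) a
      = c \<cdot> P_map P b \<cdot> (comult P A \<cdot> P_map P a) \<cdot> comult P T"
    by (simp add: imag_comp_def comp_assoc P_obj)
  also have "\<dots> = c \<cdot> P_map P b \<cdot> P_map P (P_map P a) \<cdot> P_map P (comult P T) \<cdot> comult P T"
    by (simp add: nat comp_assoc P_obj comult_coassoc)
  also have "\<dots> = imag_comp C P T c (imag_comp C P T b a)"
    by (simp add: imag_comp_def comp_assoc P_obj P_comp)
  finally show ?thesis .
qed

lemma real_comp_imag:
  assumes "T \<in> Obj C" "a \<in> Arr C" "Dom C a = P_obj P T" "b \<in> Arr C" "Dom C b = P_obj P (Cod C a)"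
    and "v \<in> Arr C" "Dom C v = Cod C b"
  shows "imag_comp C P T (v \<cdot> b) a = v \<cdot> imag_comp C P T b a"
  using assms by (simp add: imag_comp_def comp_assoc)

lemma imag_comp_real:
  assumes "T \<in> Obj C" "a \<in> Arr C" "Dom C a = P_obj P T" "u \<in> Arr C" "Cod C a = Dom C u"
    and "b \<in> Arr C" "Dom C b = P_obj P (Cod C u)"
  shows "imag_comp C P T (b \<cdot> P_map P u) a = imag_comp C P T b (u \<cdot> a)"
  using assms by (simp add: imag_comp_def comp_assoc P_comp)

lemma counit_imag_comp:
  assumes "T \<in> Obj C" "a \<in> Arr C" "Dom C a = P_obj P T" "Cod C a = A"
  shows "imag_comp C P T (counit P A) a = a"
proof -
  have [simp]: "A \<in> Obj C" using assms Cod_Obj by blast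
  have "imag_comp C P T (counit P A) a = (counit P A \<cdot> P_map P a) \<cdot> comult P T"
    using assms by (simp add: imag_comp_def comp_assoc)
  also have "counit P A \<cdot> P_map P a = a \<cdot> counit P (P_obj P T)"
    using counit_natural[of a "P_obj P T" A] assms by (simp add: hom_iff)
  also have "(a \<cdot> counit P (P_obj P T)) \<cdot> comult P T = a"
    using assms by (simp add: comp_assoc counit_comult P_obj)
  finally show ?thesis .
qed

end

locale cartesian_comonad = comonad C P + cartesian_category C
  for C :: "('o, 'm, 'x) cartesian_scheme" (structure) and P
begin

lemma imag_comp_pair:
  assumes "T \<in> Obj C" "a \<in> Arr C" "Dom C a = P_obj P T"
    and "b \<in> Arr C" "Dom C b = P_obj P (Cod C a)" "c \<in> Arr C" "Dom C c = P_obj P (Cod C a)"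
  shows "imag_comp C P T (pair C b c) a = pair C (imag_comp C P T b a) (imag_comp C P T c a)"
  using assms by (simp add: imag_comp_def pair_comp)

lemma arr_imag_prod [simp]:
  assumes "A \<in> Obj C" "B \<in> Obj C"
    and "a \<in> Arr C" "Dom C a = P_obj P A" "b \<in> Arr C" "Dom C b = P_obj P B"
  shows "imag_prod C P A B a b \<in> Arr C" "Dom C (imag_prod C P A B a b) = P_obj P (Prod C A B)"
    "Cod C (imag_prod C P A B a b) = Prod C (Cod C a) (Cod C b)"
  using assms by (simp_all add: imag_prod_def)

lemma imag_prod_pair:
  assumes [simp]: "T \<in> Obj C" "A \<in> Obj C" "B \<in> Obj C"
    and [simp]: "u \<in> Arr C" "Dom C u = P_obj P T" "Cod C u = A"
    "v \<in> Arr C" "Dom C v = P_obj P T" "Cod C v = B"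
    and [simp]: "a \<in> Arr C" "Dom C a = P_obj P A" "b \<in> Arr C" "Dom C b = P_obj P B"
  shows "imag_comp C P T (imag_prod C P A B a b) (pair C u v)
    = pair C (imag_comp C P T a u) (imag_comp C P T b v)"
  by (simp add: imag_prod_def imag_comp_pair imag_comp_real)

end

section \<open>The addition of imaginary elements\<close>

text \<open>The stage \<open>T\<close> is an argument because it cannot be recovered from the domain \<open>P_obj P T\<close> of
  \<open>x\<close>, whereas the object in which the sum is taken is the codomain of \<open>x\<close>.\<close>

definition imag_sum ::
  "('o, 'm, 'x) bicartesian_scheme \<Rightarrow> ('o, 'm) comonad_data \<Rightarrow> ('o \<Rightarrow> 'o \<Rightarrow> 'm)
    \<Rightarrow> 'o \<Rightarrow> 'm \<Rightarrow> 'm \<Rightarrow> 'm" where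
  "imag_sum C P t T x y = imag_comp C P T (imag_add C t (Cod C x)) (pair C x y)"

locale imaginary_splitting = cartesian_comonad C P
  for C :: "('o, 'm, 'x) bicartesian_scheme" (structure) and P +
  fixes t :: "'o \<Rightarrow> 'o \<Rightarrow> 'm"
  assumes pointed: "pointed C"
    and coproducts: "chosen_coproducts C"
    and splitting: "natural_imaginary_splitting C P t"
begin

lemmas arr_zero' [simp] = arr_zero[OF pointed]
lemmas comp_zero' [simp] = comp_zero[OF pointed]
lemmas zero_comp' [simp] = zero_comp[OF pointed]

lemma coproduct:
  assumes "A \<in> Obj C" "B \<in> Obj C"
  shows "is_coproduct C A B (Coprod C A B) (In1 C A B) (In2 C A B)"
  using coproducts assms by (simp add: chosen_coproducts_def)

lemma arr_inj [simp]:
  assumes "A \<in> Obj C" "B \<in> Obj C"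
  shows "In1 C A B \<in> Arr C" "Cod C (In1 C A B) = Coprod C A B" "Dom C (In1 C A B) = A"
    "In2 C A B \<in> Arr C" "Cod C (In2 C A B) = Coprod C A B" "Dom C (In2 C A B) = B"
  using coproduct[OF assms] by (auto simp: is_coproduct_def hom_iff)

lemma coprod_arr_eqI:
  assumes "A \<in> Obj C" "B \<in> Obj C" "h \<in> hom C (Coprod C A B) X" "k \<in> hom C (Coprod C A B) X"
    and "h \<cdot> In1 C A B = k \<cdot> In1 C A B" "h \<cdot> In2 C A B = k \<cdot> In2 C A B"
  shows "h = k"
proof -
  have "X \<in> Obj C" "k \<cdot> In1 C A B \<in> hom C A X" "k \<cdot> In2 C A B \<in> hom C B X"
    using assms Cod_Obj by (auto simp: hom_iff)
  then show ?thesis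
    using coproduct[OF assms(1,2)] assms(3-6) unfolding is_coproduct_def by metis
qed

lemma copair_spec:
  assumes "f \<in> Arr C" "g \<in> Arr C" "Cod C f = Cod C g"
  shows "copair C f g \<in> hom C (Coprod C (Dom C f) (Dom C g)) (Cod C f) \<and>
    copair C f g \<cdot> In1 C (Dom C f) (Dom C g) = f \<and> copair C f g \<cdot> In2 C (Dom C f) (Dom C g) = g"
  unfolding copair_def
proof (rule theI')
  have "Cod C f \<in> Obj C" "f \<in> hom C (Dom C f) (Cod C f)" "g \<in> hom C (Dom C g) (Cod C f)"
    using assms Cod_Obj by (auto simp: hom_iff)
  then show "\<exists>!h. h \<in> hom C (Coprod C (Dom C f) (Dom C g)) (Cod C f) \<and>
     h \<cdot> In1 C (Dom C f) (Dom C g) = f \<and> h \<cdot> In2 C (Dom C f) (Dom C g) = g"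
    using coproduct[OF Dom_Obj Dom_Obj, of f g] assms unfolding is_coproduct_def by blast
qed

lemma arr_copair [simp]:
  assumes "f \<in> Arr C" "g \<in> Arr C" "Cod C f = Cod C g"
  shows "copair C f g \<in> Arr C" "Cod C (copair C f g) = Cod C g"
    "Dom C (copair C f g) = Coprod C (Dom C f) (Dom C g)"
  using copair_spec[OF assms] assms(3) by (auto simp: hom_iff)

lemma copair_inj [simp]:
  assumes "f \<in> Arr C" "g \<in> Arr C" "Cod C f = Cod C g" "Dom C f = A" "Dom C g = B"
  shows "copair C f g \<cdot> In1 C A B = f" "copair C f g \<cdot> In2 C A B = g"
  using copair_spec[OF assms(1-3)] assms(4,5) by auto

lemma comp_copair:
  assumes "f \<in> Arr C" "g \<in> Arr C" "h \<in> Arr C" "Cod C f = Dom C h" "Cod C g = Dom C h"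
  shows "h \<cdot> copair C f g = copair C (h \<cdot> f) (h \<cdot> g)"
  by (rule coprod_arr_eqI[of "Dom C f" "Dom C g" _ "Cod C h"])
    (use assms Dom_Obj in \<open>auto simp: hom_iff comp_assoc\<close>)

lemma arr_coprod_map [simp]:
  assumes "f \<in> Arr C" "g \<in> Arr C"
  shows "coprod_map C f g \<in> Arr C" "Dom C (coprod_map C f g) = Coprod C (Dom C f) (Dom C g)"
    "Cod C (coprod_map C f g) = Coprod C (Cod C f) (Cod C g)"
  using assms Cod_Obj by (auto simp: coprod_map_def)

lemma copair_coprod_map:
  assumes "f \<in> Arr C" "g \<in> Arr C" "u \<in> Arr C" "v \<in> Arr C" "Cod C u = Cod C v"
    "Dom C u = Cod C f" "Dom C v = Cod C g"
  shows "copair C u v \<cdot> coprod_map C f g = copair C (u \<cdot> f) (v \<cdot> g)"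
  using assms Cod_Obj by (simp add: coprod_map_def comp_copair flip: comp_assoc)

lemma arr_t [simp]:
  assumes "A \<in> Obj C" "B \<in> Obj C"
  shows "t A B \<in> Arr C" "Dom C (t A B) = P_obj P (Prod C A B)" "Cod C (t A B) = Coprod C A B"
  using splitting assms by (auto simp: natural_imaginary_splitting_def hom_iff)

lemma t_section:
  assumes "A \<in> Obj C" "B \<in> Obj C"
  shows "coprod_to_prod C A B \<cdot> t A B = counit P (Prod C A B)"
  using splitting assms by (auto simp: natural_imaginary_splitting_def)

lemma t_natural:
  assumes "f \<in> Arr C" "g \<in> Arr C"
  shows "t (Cod C f) (Cod C g) \<cdot> P_map P (prod_map C f g)
    = coprod_map C f g \<cdot> t (Dom C f) (Dom C g)"
  using splitting assms by (auto simp: natural_imaginary_splitting_def)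

lemma arr_imag_add [simp]:
  assumes "X \<in> Obj C"
  shows "imag_add C t X \<in> Arr C" "Dom C (imag_add C t X) = P_obj P (Prod C X X)"
    "Cod C (imag_add C t X) = X"
  using assms by (auto simp: imag_add_def)

text \<open>Naturality of \<open>t\<close> in both variables separately: \<open>f a + g b\<close> is the value of the copairing of
  \<open>f\<close> and \<open>g\<close> at \<open>t (a, b)\<close>. The case \<open>f = g\<close> gives naturality of the addition, and the case where
  one of the arrows starts at a zero object gives the unit laws.\<close>

lemma imag_add_prod_map:
  assumes [simp]: "f \<in> Arr C" "g \<in> Arr C" "Cod C f = X" "Cod C g = X"
  shows "imag_add C t X \<cdot> P_map P (prod_map C f g) = copair C f g \<cdot> t (Dom C f) (Dom C g)"
proof -
  have [simp]: "X \<in> Obj C" using Cod_Obj[of f] by simp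
  have "imag_add C t X \<cdot> P_map P (prod_map C f g)
      = copair C (Ident C X) (Ident C X) \<cdot> t X X \<cdot> P_map P (prod_map C f g)"
    by (simp add: imag_add_def comp_assoc)
  also have "t X X \<cdot> P_map P (prod_map C f g) = coprod_map C f g \<cdot> t (Dom C f) (Dom C g)"
    using t_natural[of f g] by simp
  also have "copair C (Ident C X) (Ident C X) \<cdot> coprod_map C f g \<cdot> t (Dom C f) (Dom C g)
      = copair C f g \<cdot> t (Dom C f) (Dom C g)"
    by (simp add: Dom_Obj copair_coprod_map flip: comp_assoc)
  finally show ?thesis .
qed

lemma imag_add_natural:
  assumes [simp]: "f \<in> Arr C"
  shows "f \<cdot> imag_add C t (Dom C f) = imag_add C t (Cod C f) \<cdot> P_map P (prod_map C f f)"
  by (simp add: imag_add_prod_map) (simp add: imag_add_def Dom_Obj comp_copair flip: comp_assoc)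

text \<open>For a zero object \<open>Z\<close> the copairing of the identity of \<open>X\<close> with the arrow from \<open>Z\<close> is the
  first component of the comparison \<open>X + Z \<rightarrow> X \<times> Z\<close>, which turns \<open>t\<close> into the counit. Thus
  adding \<open>0\<close> amounts to a projection.\<close>

lemma imag_add_unit:
  assumes [simp]: "X \<in> Obj C"
  shows "imag_add C t X \<cdot> P_map P (pair C (Ident C X) (zero_arr C X X)) = counit P X"
    and "imag_add C t X \<cdot> P_map P (pair C (zero_arr C X X) (Ident C X)) = counit P X"
proof -
  obtain Z u i where Z: "is_zero_object C Z" and u: "u \<in> hom C X Z" and i: "i \<in> hom C Z X"
    and ui: "zero_arr C X X = i \<cdot> u" using zero_arr_factors[OF pointed assms assms] .
  have [simp]: "Z \<in> Obj C" using Z by (simp add: is_zero_object_def is_initial_def)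
  have [simp]: "u \<in> Arr C" "Dom C u = X" "Cod C u = Z" "i \<in> Arr C" "Dom C i = Z" "Cod C i = X"
    using u i by (auto simp: hom_iff)
  have i0: "zero_arr C Z X = i"
    using zero_arr_eq[OF Z Ident_hom i] by simp
  let ?l = "pair C (Ident C X) u" and ?r = "pair C u (Ident C X)"
  have c: "coprod_to_prod C A B \<in> Arr C" "Dom C (coprod_to_prod C A B) = Coprod C A B"
    "Cod C (coprod_to_prod C A B) = Prod C A B"
    "Pr1 C A B \<cdot> coprod_to_prod C A B = copair C (Ident C A) (zero_arr C B A)"
    "Pr2 C A B \<cdot> coprod_to_prod C A B = copair C (zero_arr C A B) (Ident C B)"
    if [simp]: "A \<in> Obj C" "B \<in> Obj C" for A B
    by (auto simp: coprod_to_prod_def)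
  have nat: "counit P (Cod C f) \<cdot> P_map P f = f \<cdot> counit P (Dom C f)" if "f \<in> Arr C" for f
    using counit_natural[of f] that by (simp add: hom_iff)
  have "pair C (Ident C X) (zero_arr C X X) = prod_map C (Ident C X) i \<cdot> ?l"
    by (simp add: prod_map_pair ui)
  then have "imag_add C t X \<cdot> P_map P (pair C (Ident C X) (zero_arr C X X))
      = (imag_add C t X \<cdot> P_map P (prod_map C (Ident C X) i)) \<cdot> P_map P ?l"
    by (simp add: P_comp comp_assoc)
  also have "\<dots> = (copair C (Ident C X) i \<cdot> t X Z) \<cdot> P_map P ?l"
    by (simp add: imag_add_prod_map)
  also have "copair C (Ident C X) i \<cdot> t X Z = Pr1 C X Z \<cdot> counit P (Prod C X Z)"
    using c[of X Z] by (simp add: i0 flip: t_section) (simp flip: comp_assoc)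
  also have "(\<dots>) \<cdot> P_map P ?l = counit P X"
    using nat[of ?l] by (simp add: comp_assoc)
  finally show "imag_add C t X \<cdot> P_map P (pair C (Ident C X) (zero_arr C X X)) = counit P X" .
  have "pair C (zero_arr C X X) (Ident C X) = prod_map C i (Ident C X) \<cdot> ?r"
    by (simp add: prod_map_pair ui)
  then have "imag_add C t X \<cdot> P_map P (pair C (zero_arr C X X) (Ident C X))
      = (imag_add C t X \<cdot> P_map P (prod_map C i (Ident C X))) \<cdot> P_map P ?r"
    by (simp add: P_comp comp_assoc)
  also have "\<dots> = (copair C i (Ident C X) \<cdot> t Z X) \<cdot> P_map P ?r"
    by (simp add: imag_add_prod_map)
  also have "copair C i (Ident C X) \<cdot> t Z X = Pr2 C Z X \<cdot> counit P (Prod C Z X)"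
    using c[of Z X] by (simp add: i0 flip: t_section) (simp flip: comp_assoc)
  also have "(\<dots>) \<cdot> P_map P ?r = counit P X"
    using nat[of ?r] by (simp add: comp_assoc)
  finally show "imag_add C t X \<cdot> P_map P (pair C (zero_arr C X X) (Ident C X)) = counit P X" .
qed

lemma arr_imag_sum [simp]:
  assumes "T \<in> Obj C" "x \<in> Arr C" "y \<in> Arr C"
    and "Dom C x = P_obj P T" "Dom C y = P_obj P T" "Cod C y = Cod C x"
  shows "imag_sum C P t T x y \<in> Arr C" "Dom C (imag_sum C P t T x y) = P_obj P T"
    "Cod C (imag_sum C P t T x y) = Cod C x"
  using assms Cod_Obj[of x] by (auto simp: imag_sum_def)

text \<open>Precomposition acts inside the pair, since products are also products for imaginary
  morphisms. Through this change of stage, identities stated for generic elements, as in the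
  definition of special objects, apply to arbitrary ones.\<close>

lemma imag_sum_comp:
  assumes [simp]: "T \<in> Obj C" "S \<in> Obj C" "x \<in> Arr C" "y \<in> Arr C"
    "Dom C x = P_obj P T" "Dom C y = P_obj P T" "Cod C y = Cod C x"
    "a \<in> Arr C" "Dom C a = P_obj P S" "Cod C a = T"
  shows "imag_comp C P S (imag_sum C P t T x y) a
    = imag_sum C P t S (imag_comp C P S x a) (imag_comp C P S y a)"
  using Cod_Obj[of x]
  by (simp add: imag_sum_def hom_iff imag_comp_pair
      imag_comp_assoc[where A = T and B = "Prod C (Cod C x) (Cod C x)" and D = "Cod C x"])

text \<open>Additivity of \<open>f\<close> is naturality of the addition evaluated at \<open>(x, y)\<close>. It relies on \<open>f\<close> being
  real, because naturality of the splitting concerns real arrows only.\<close>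

lemma real_imag_sum:
  assumes [simp]: "T \<in> Obj C" "x \<in> Arr C" "y \<in> Arr C"
    "Dom C x = P_obj P T" "Dom C y = P_obj P T" "Cod C y = Cod C x"
    "f \<in> Arr C" "Dom C f = Cod C x"
  shows "f \<cdot> imag_sum C P t T x y = imag_sum C P t T (f \<cdot> x) (f \<cdot> y)"
proof -
  have [simp]: "Cod C x \<in> Obj C" "Cod C f \<in> Obj C" using Cod_Obj by auto
  have "f \<cdot> imag_sum C P t T x y = imag_comp C P T (f \<cdot> imag_add C t (Cod C x)) (pair C x y)"
    by (simp add: imag_sum_def real_comp_imag)
  also have "\<dots> = imag_comp C P T (imag_add C t (Cod C f)) (prod_map C f f \<cdot> pair C x y)"
    using imag_add_natural[of f] by (simp add: imag_comp_real)
  also have "\<dots> = imag_sum C P t T (f \<cdot> x) (f \<cdot> y)"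
    by (simp add: prod_map_pair imag_sum_def)
  finally show ?thesis .
qed

lemma imag_sum_zero:
  assumes [simp]: "T \<in> Obj C" "x \<in> Arr C" "Dom C x = P_obj P T" "Cod C x = X"
  shows "imag_sum C P t T x (zero_arr C (P_obj P T) X) = x"
    and "imag_sum C P t T (zero_arr C (P_obj P T) X) x = x"
proof -
  have [simp]: "X \<in> Obj C" "P_obj P T \<in> Obj C" using Cod_Obj[of x] Dom_Obj[of x] by auto
  have "pair C x (zero_arr C (P_obj P T) X) = pair C (Ident C X) (zero_arr C X X) \<cdot> x"
    and "pair C (zero_arr C (P_obj P T) X) x = pair C (zero_arr C X X) (Ident C X) \<cdot> x"
    by (simp_all add: pair_comp)
  then show "imag_sum C P t T x (zero_arr C (P_obj P T) X) = x"
    and "imag_sum C P t T (zero_arr C (P_obj P T) X) x = x"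
    by (simp_all add: imag_sum_def imag_add_unit counit_imag_comp flip: imag_comp_real)
qed

text \<open>The associativity hypothesis is the identity for the generic triple, the projections; the
  general case follows by changing the stage along \<open>((x, y), z)\<close>.\<close>

lemma imag_sum_assoc:
  assumes "associative_addition C P t"
    and [simp]: "T \<in> Obj C" "x \<in> Arr C" "y \<in> Arr C" "z \<in> Arr C" "Dom C x = P_obj P T"
    "Dom C y = P_obj P T" "Dom C z = P_obj P T" "Cod C x = X" "Cod C y = X" "Cod C z = X"
  shows "imag_sum C P t T (imag_sum C P t T x y) z = imag_sum C P t T x (imag_sum C P t T y z)"
proof -
  have [simp]: "X \<in> Obj C" using Cod_Obj[of x] by simp
  let ?m = "imag_add C t X" and ?i = "counit P X"
  let ?L = "Prod C (Prod C X X) X" and ?R = "Prod C X (Prod C X X)"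
  let ?l = "imag_prod C P (Prod C X X) X ?m ?i" and ?r = "imag_prod C P X (Prod C X X) ?i ?m"
  let ?\<alpha> = "prod_assoc C X X X" and ?e = "pair C (pair C x y) z"
  have hyp: "imag_comp C P ?L ?m ?l = imag_comp C P ?R ?m ?r \<cdot> P_map P ?\<alpha>"
    using assms(1) by (simp add: associative_addition_def real_imag_def)
  have \<alpha> [simp]: "?\<alpha> \<in> Arr C" "Dom C ?\<alpha> = ?L" "Cod C ?\<alpha> = ?R"
    by (simp_all add: prod_assoc_def)
  have \<alpha>e: "?\<alpha> \<cdot> ?e = pair C x (pair C y z)"
    by (simp add: prod_assoc_def pair_comp comp_assoc)
  have "imag_sum C P t T (imag_sum C P t T x y) z = imag_comp C P T ?m (imag_comp C P T ?l ?e)"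
    by (simp add: imag_prod_pair counit_imag_comp imag_sum_def)
  also have "\<dots> = imag_comp C P T (imag_comp C P ?L ?m ?l) ?e"
    by (rule imag_comp_assoc[symmetric]) (simp_all add: hom_iff)
  also have "\<dots> = imag_comp C P T (imag_comp C P ?R ?m ?r) (pair C x (pair C y z))"
    unfolding hyp by (simp add: imag_comp_real \<alpha>e)
  also have "\<dots> = imag_comp C P T ?m (imag_comp C P T ?r (pair C x (pair C y z)))"
    by (rule imag_comp_assoc) (simp_all add: hom_iff)
  also have "\<dots> = imag_sum C P t T x (imag_sum C P t T y z)"
    by (simp add: imag_prod_pair counit_imag_comp imag_sum_def)
  finally show ?thesis .
qed

section \<open>Special objects have invertible imaginary elements\<close>

text \<open>In \<open>Y \<times> Y\<close> the kernel consists of the pairs \<open>(x, 0)\<close> and the section yields the pairs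
  \<open>(y, y)\<close>. Writing \<open>x - y\<close> for \<open>q (x, y)\<close>, the first Schreier identity reads
  \<open>(x - y, 0) + (y, y) = (x, y)\<close>, and its first coordinate is \<open>(x - y) + y = x\<close>. As
  \<open>(x, 0) + (y, y) = (x + y, y)\<close>, the second one reads \<open>(x + y) - y = x\<close>.\<close>

lemma special_object_subtraction:
  assumes "intrinsic_Schreier_special C P t Y"
  obtains q where "q \<in> hom C (P_obj P (Prod C Y Y)) Y"
    and "\<And>T x y. T \<in> Obj C \<Longrightarrow> x \<in> hom C (P_obj P T) Y \<Longrightarrow> y \<in> hom C (P_obj P T) Y \<Longrightarrow>
      imag_sum C P t T (imag_comp C P T q (pair C x y)) y = x"
    and "\<And>T x y. T \<in> Obj C \<Longrightarrow> x \<in> hom C (P_obj P T) Y \<Longrightarrow> y \<in> hom C (P_obj P T) Y \<Longrightarrow>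
      imag_comp C P T q (pair C (imag_sum C P t T x y) y) = x"
proof -
  have Y [simp]: "Y \<in> Obj C" using assms by (simp add: intrinsic_Schreier_special_def)
  let ?YY = "Prod C Y Y" and ?f = "Pr2 C Y Y"
  let ?s = "pair C (Ident C Y) (Ident C Y)" and ?k = "pair C (Ident C Y) (zero_arr C Y Y)"
  obtain q where q: "q \<in> hom C (P_obj P ?YY) Y"
    and e1: "imag_comp C P ?YY (imag_add C t ?YY) (pair C (?k \<cdot> q) (real_imag C P (?s \<cdot> ?f)))
           = real_imag C P (Ident C ?YY)"
    and e2: "imag_comp C P ?YY q (imag_add C t ?YY \<cdot> P_map P (prod_map C ?k ?s))
           = real_imag C P (Pr1 C Y Y)"
    using assms
    unfolding intrinsic_Schreier_special_def intrinsic_Schreier_split_epi_def imag_hom_def Let_def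
    by auto
  have [simp]: "q \<in> Arr C" "Dom C q = P_obj P ?YY" "Cod C q = Y" using q by (auto simp: hom_iff)
  have PYY [simp]: "P_obj P ?YY \<in> Obj C" by (simp add: P_obj)
  have "imag_sum C P t ?YY (?k \<cdot> q) (?s \<cdot> ?f \<cdot> counit P ?YY) = counit P ?YY"
    using e1 by (simp add: imag_sum_def real_imag_def comp_assoc)
  then have "Pr1 C Y Y \<cdot> imag_sum C P t ?YY (?k \<cdot> q) (?s \<cdot> ?f \<cdot> counit P ?YY)
      = Pr1 C Y Y \<cdot> counit P ?YY" by simp
  then have e1': "imag_sum C P t ?YY q (?f \<cdot> counit P ?YY) = Pr1 C Y Y \<cdot> counit P ?YY"
    by (simp add: real_imag_sum)
  show thesis
  proof (rule that[OF q])
    fix T x y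
    assume T [simp]: "T \<in> Obj C" and x: "x \<in> hom C (P_obj P T) Y" and y: "y \<in> hom C (P_obj P T) Y"
    have [simp]: "x \<in> Arr C" "Dom C x = P_obj P T" "Cod C x = Y"
      "y \<in> Arr C" "Dom C y = P_obj P T" "Cod C y = Y" using x y by (auto simp: hom_iff)
    have "imag_comp C P T (imag_sum C P t ?YY q (?f \<cdot> counit P ?YY)) (pair C x y)
        = imag_comp C P T (Pr1 C Y Y \<cdot> counit P ?YY) (pair C x y)"
      by (simp add: e1')
    then show "imag_sum C P t T (imag_comp C P T q (pair C x y)) y = x"
      by (simp add: imag_sum_comp real_comp_imag counit_imag_comp)
    have PT [simp]: "P_obj P T \<in> Obj C" by (simp add: P_obj)
    have "imag_comp C P T (imag_add C t ?YY \<cdot> P_map P (prod_map C ?k ?s)) (pair C x y)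
        = imag_sum C P t T (?k \<cdot> x) (?s \<cdot> y)"
      by (simp add: imag_comp_real prod_map_pair imag_sum_def)
    also have "\<dots> = pair C (imag_sum C P t T x y) y"
      by (rule prod_arr_eqI[of Y Y _ "P_obj P T"])
        (simp_all add: hom_iff real_imag_sum imag_sum_zero)
    finally have sum: "imag_comp C P T (imag_add C t ?YY \<cdot> P_map P (prod_map C ?k ?s)) (pair C x y)
        = pair C (imag_sum C P t T x y) y" .
    have "imag_comp C P T (imag_comp C P ?YY q (imag_add C t ?YY \<cdot> P_map P (prod_map C ?k ?s)))
        (pair C x y) = imag_comp C P T q (pair C (imag_sum C P t T x y) y)"
      by (subst imag_comp_assoc) (simp_all add: hom_iff sum)
    then show "imag_comp C P T q (pair C (imag_sum C P t T x y) y) = x"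
      unfolding e2 by (simp add: real_imag_def real_comp_imag counit_imag_comp)
  qed
qed

text \<open>The negative of \<open>y\<close> is \<open>0 - y\<close>, which is a left inverse by the first subtraction law. Then
  \<open>(y + (0 - y)) + y = y + ((0 - y) + y) = y = 0 + y\<close>, and the second law cancels \<open>y\<close> on the
  right, so it is also a right inverse.\<close>

lemma special_object_negation:
  assumes assoc: "associative_addition C P t" and special: "intrinsic_Schreier_special C P t Y"
    and T [simp]: "T \<in> Obj C" and y: "y \<in> hom C (P_obj P T) Y"
  obtains y' where "y' \<in> hom C (P_obj P T) Y"
    and "imag_sum C P t T y' y = zero_arr C (P_obj P T) Y"
    and "imag_sum C P t T y y' = zero_arr C (P_obj P T) Y"
proof -
  obtain q where q: "q \<in> hom C (P_obj P (Prod C Y Y)) Y"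
    and sub_add: "\<And>x y. x \<in> hom C (P_obj P T) Y \<Longrightarrow> y \<in> hom C (P_obj P T) Y \<Longrightarrow>
      imag_sum C P t T (imag_comp C P T q (pair C x y)) y = x"
    and add_sub: "\<And>x y. x \<in> hom C (P_obj P T) Y \<Longrightarrow> y \<in> hom C (P_obj P T) Y \<Longrightarrow>
      imag_comp C P T q (pair C (imag_sum C P t T x y) y) = x"
    using special_object_subtraction[OF special] T by metis
  have [simp]: "y \<in> Arr C" "Dom C y = P_obj P T" "Cod C y = Y" using y by (auto simp: hom_iff)
  have [simp]: "q \<in> Arr C" "Dom C q = P_obj P (Prod C Y Y)" "Cod C q = Y"
    using q by (auto simp: hom_iff)
  have [simp]: "Y \<in> Obj C" "P_obj P T \<in> Obj C" using Cod_Obj[of y] by (auto simp: P_obj)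
  let ?z = "zero_arr C (P_obj P T) Y"
  let ?y' = "imag_comp C P T q (pair C ?z y)"
  have y': "?y' \<in> hom C (P_obj P T) Y" by (simp add: hom_iff)
  have left: "imag_sum C P t T ?y' y = ?z" using sub_add[OF _ y] by (simp add: hom_iff)
  have "imag_sum C P t T (imag_sum C P t T y ?y') y = imag_sum C P t T ?z y"
    using left by (simp add: imag_sum_assoc[OF assoc, where X = Y] imag_sum_zero)
  then have "imag_sum C P t T y ?y' = ?z"
    using add_sub[OF _ y, of "imag_sum C P t T y ?y'"] add_sub[OF _ y, of ?z] by (simp add: hom_iff)
  with that y' left show thesis by blast
qed

section \<open>Pullbacks of split epimorphisms over a special object\<close>

text \<open>The counit being a regular epimorphism is what allows an imaginary decomposition of \<open>W\<close>
  to constrain real subobjects: real arrows are additive, so the decomposition factors the counit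
  through every subobject containing both summands.\<close>

lemma jointly_extremal_epi_if_decomposition:
  assumes cover: "regular_epi C (counit P W)" and [simp]: "W \<in> Obj C"
    and [simp]: "k \<in> Arr C" "Cod C k = W" "s \<in> Arr C" "Cod C s = W"
    and [simp]: "q \<in> Arr C" "Dom C q = P_obj P W" "Cod C q = Dom C k"
    and [simp]: "r \<in> Arr C" "Dom C r = P_obj P W" "Cod C r = Dom C s"
    and decomp: "imag_sum C P t W (k \<cdot> q) (s \<cdot> r) = counit P W"
  shows "jointly_extremal_epi C k s"
  unfolding jointly_extremal_epi_def
proof (intro conjI allI impI)
  fix m k1 s1
  assume "is_mono C m \<and> Cod C m = Cod C k \<and> k1 \<in> hom C (Dom C k) (Dom C m) \<and>
    s1 \<in> hom C (Dom C s) (Dom C m) \<and> m \<cdot> k1 = k \<and> m \<cdot> s1 = s"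
  then have m: "is_mono C m" and [simp]: "Cod C m = W" "k1 \<in> Arr C" "Dom C k1 = Dom C k"
    "Cod C k1 = Dom C m" "s1 \<in> Arr C" "Dom C s1 = Dom C s" "Cod C s1 = Dom C m"
    and mk: "m \<cdot> k1 = k" and ms: "m \<cdot> s1 = s"
    by (auto simp: hom_iff)
  have [simp]: "m \<in> Arr C" using m by (simp add: is_mono_def)
  let ?h = "imag_sum C P t W (k1 \<cdot> q) (s1 \<cdot> r)"
  have "m \<cdot> ?h = imag_sum C P t W (k \<cdot> q) (s \<cdot> r)"
    by (simp add: real_imag_sum comp_reassoc[OF mk] comp_reassoc[OF ms])
  with decomp show "is_iso C m"
    by (intro regular_epi_through_mono[OF cover m, of ?h]) (simp_all add: hom_iff)
qed simp_all

text \<open>For elements \<open>(x, z)\<close> of the pullback \<open>W\<close> one has, with \<open>y = f x = g z\<close>,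
  \<open>(x, z) = (x + s (-y), 0) + (s y, z)\<close>. The first summand lies in the kernel because
  \<open>f (x + s (-y)) = y + (-y) = 0\<close>, the second is \<open>s' z\<close>, and the first coordinates agree because
  \<open>(x + s (-y)) + s y = x + s (-y + y) = x\<close>; so both one-sided inverse laws in \<open>Y\<close> are used. The
  argument is applied to the generic element of \<open>W\<close>, the counit. Only \<open>y\<close>, an element of \<open>Y\<close>, is
  ever negated.\<close>

lemma special_pullback_strong:
  assumes assoc: "associative_addition C P t" and special: "intrinsic_Schreier_special C P t Y"
    and cover: "\<And>X. X \<in> Obj C \<Longrightarrow> regular_epi C (counit P X)"
    and fs: "split_epi C f s" "Cod C f = Y"
    and pb: "is_pullback C g' f' f g"
    and s': "s' \<in> hom C (Dom C g) (Dom C f')" "g' \<cdot> s' = s \<cdot> g" "f' \<cdot> s' = Ident C (Dom C g)"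
  shows "strong_split_epi C f' s'"
proof -
  define W where "W = Dom C f'"
  define X where "X = Dom C f"
  define Z where "Z = Dom C g"
  have [simp]: "f \<in> Arr C" "Dom C f = X" "Cod C f = Y" "s \<in> Arr C" "Dom C s = Y" "Cod C s = X"
    "g \<in> Arr C" "Dom C g = Z" "Cod C g = Y" "g' \<in> Arr C" "Dom C g' = W" "Cod C g' = X"
    "f' \<in> Arr C" "Dom C f' = W" "Cod C f' = Z" "s' \<in> Arr C" "Dom C s' = Z" "Cod C s' = W"
    using fs pullback_arr[OF pb] s'(1)
    by (simp_all add: W_def X_def Z_def split_epi_def hom_iff)
  have [simp]: "W \<in> Obj C" "X \<in> Obj C" "Y \<in> Obj C" "Z \<in> Obj C"
    using Dom_Obj[of f] Cod_Obj[of f] Dom_Obj[of f'] Dom_Obj[of g] by auto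
  have [simp]: "P_obj P W \<in> Obj C" by (simp add: P_obj)
  have sq: "f \<cdot> g' = g \<cdot> f'" using pullback_arr[OF pb] by simp
  have fs1: "f \<cdot> s = Ident C Y" using fs by (simp add: split_epi_def)
  let ?e = "counit P W" and ?z = "zero_arr C (P_obj P W)"
  let ?x = "g' \<cdot> ?e"
  let ?y = "f \<cdot> ?x"
  have sq': "?y = g \<cdot> f' \<cdot> ?e" using sq by (simp flip: comp_assoc)
  obtain y' where y': "y' \<in> hom C (P_obj P W) Y"
    and l: "imag_sum C P t W y' ?y = ?z Y" and r: "imag_sum C P t W ?y y' = ?z Y"
    by (rule special_object_negation[OF assoc special \<open>W \<in> Obj C\<close>, of ?y]) (simp_all add: hom_iff)
  have [simp]: "y' \<in> Arr C" "Dom C y' = P_obj P W" "Cod C y' = Y" using y' by (auto simp: hom_iff)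
  let ?kx = "imag_sum C P t W ?x (s \<cdot> y')"
  have fkx: "f \<cdot> ?kx = ?z Y"
    using r by (simp add: real_imag_sum) (simp add: fs1 flip: comp_assoc)
  obtain u where u: "u \<in> hom C (P_obj P W) W" and gu: "g' \<cdot> u = ?kx" and fu: "f' \<cdot> u = ?z Z"
    by (rule pullback_lift[OF pb, of "P_obj P W" ?kx "?z Z"]) (simp_all add: hom_iff fkx)
  have [simp]: "u \<in> Arr C" "Dom C u = P_obj P W" "Cod C u = W" using u by (auto simp: hom_iff)
  have decomp: "imag_sum C P t W u (s' \<cdot> f' \<cdot> ?e) = ?e" (is "?w = ?e")
  proof -
    have s'1: "g' \<cdot> s' \<cdot> f' \<cdot> ?e = s \<cdot> ?y"
      using s'(2) sq' by (simp add: comp_reassoc[OF s'(2)] comp_assoc)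
    have s'2: "f' \<cdot> s' \<cdot> f' \<cdot> ?e = f' \<cdot> ?e"
      using s'(3) by (simp add: comp_reassoc[OF s'(3)])
    have "g' \<cdot> ?w = imag_sum C P t W ?kx (s \<cdot> ?y)"
      by (simp add: real_imag_sum gu s'1)
    also have "\<dots> = imag_sum C P t W ?x (s \<cdot> imag_sum C P t W y' ?y)"
      by (simp add: imag_sum_assoc[OF assoc, where X = X] real_imag_sum)
    also have "\<dots> = ?x" by (simp add: l imag_sum_zero)
    finally have g: "g' \<cdot> ?w = ?x" .
    have f: "f' \<cdot> ?w = f' \<cdot> ?e"
      by (simp add: real_imag_sum fu s'2 imag_sum_zero)
    show ?thesis
      by (rule pullback_arr_eqI[OF pb, where X = "P_obj P W"]) (simp_all add: hom_iff g f)
  qed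
  show ?thesis
    unfolding strong_split_epi_def
  proof (intro conjI allI impI)
    show "split_epi C f' s'" using s' by (simp add: split_epi_def hom_iff)
    fix k assume k: "is_kernel C k f'"
    then have [simp]: "k \<in> Arr C" "Cod C k = W"
      using kernel_arr[OF k] by simp_all
    obtain q where q: "q \<in> hom C (P_obj P W) (Dom C k)" and kq: "k \<cdot> q = u"
      by (rule kernel_lift[OF k, of u]) (simp_all add: fu)
    have [simp]: "q \<in> Arr C" "Dom C q = P_obj P W" "Cod C q = Dom C k" using q by (auto simp: hom_iff)
    show "jointly_extremal_epi C k s'"
      by (rule jointly_extremal_epi_if_decomposition[OF cover, of W _ _ q "f' \<cdot> ?e"])
        (simp_all add: kq decomp)
  qed
qed

end

theorem corollary10p4:
  fixes C :: "('o, 'm) bicartesian"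
    and P :: "('o, 'm) comonad_data"
    and t :: "'o \<Rightarrow> 'o \<Rightarrow> 'm"
  assumes "regular_category C"
    and "unital_category C"
    and "chosen_coproducts C"
    and "comonadic_covers C P"
    and "natural_imaginary_splitting C P t"
    and "associative_addition C P t"
  shows "\<forall>Y \<in> Obj C. intrinsic_Schreier_special C P t Y \<longrightarrow> protomodular_object C Y"
proof -
  interpret comonad C P using assms(4) by (simp add: comonadic_covers_def)
  interpret imaginary_splitting C P t
    using assms(2,3,5) by unfold_locales (simp_all add: unital_category_def)
  have cover: "\<And>X. X \<in> Obj C \<Longrightarrow> regular_epi C (counit P X)"
    using assms(4) by (simp add: comonadic_covers_def)
  show ?thesis
    unfolding protomodular_object_def stably_strong_def
    using special_pullback_strong[OF assms(6) _ cover] by blast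
qed

end
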